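(* Let $1<p<2$, let $q=\frac{p}{p-1}$, suppose that the Banach space $X$ is $p$-smooth and $2$-convex, and let $R(u)=\frac1p\|u\|_X^p$. Suppose that the following approximate source conditions hold with some orders $r_1,r_2\ge0$, $r_1<1$, and a constant $C$: for all sufficiently small $\beta>0$, $$\inf_{w\in Y}\Big\{\tfrac1\beta\|K^*w-\mu^\dagger\|_{X^*}^q+\tfrac12\|w\|_Y^2\Big\}\le C\beta^{-r_1},\qquad \inf_{w\in Y}\Big\{\tfrac1\beta\|K^*w-\eta\|_{X^*}^q+\tfrac12\|w\|_Y^2\Big\}\le C\beta^{-r_2}.$$ Put $\nu_i=2+r_i(q-2)$, $i=1,2$. Then for the choice $\alpha\simeq\delta^\kappa$, where $$\kappa=\begin{cases}\dfrac{\nu_1\nu_2}{\nu_1\nu_2+q(r_2-r_1)}&\text{for } r_1\le r_2,\\[2mm]1&\text{for } r_2<r_1<1,\end{cases}$$ we have $$D_R^{\mu_\alpha^\delta,\mu^\dagger}(u_\alpha^\delta,u^\dagger)\le\begin{cases}C_p\,\delta^{\frac{2\nu_2(1-r_1)}{\nu_1\nu_2+q(r_2-r_1)}}&\text{for } r_1\le r_2,\\ C_p\,\delta^{\frac{2(1-r_1)}{2+r_1(q-2)}}&\text{for } r_2<r_1<1,\end{cases}$$ where $C_p$ is a constant independent of $\delta$; for the constant $C_p$ one has $C_p\to\infty$ when $p\to2$.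
   Context: $X$ is a separable Banach space and $Y$ a separable Hilbert space, identified with its dual. $(Z,Y,Z^* )$ is a Gelfand triple: $Z\subset Y$ is a dense subspace with Banach space structure and $\langle u,v\rangle_{Z\times Z^*}=\langle u,v\rangle_Y$ for $u\in Z$, $v\in Y\subset Z^*$. $K:X\to Y$ is a continuous linear operator, also continuous as a map $X\to Z$; its adjoint extends continuously to $K^*:Z^*\to X^*$. The noisy data are $f^\delta=Ku^\dagger+\delta n\in Z^*$ with $n\in Z^*$, $\eta=K^*n$, where $u^\dagger\in X$ is a solution of $Ku=f$ minimizing $R$ among all solutions, and $\mu^\dagger\in\partial R(u^\dagger)$. For $\alpha,\delta>0$, $u_\alpha^\delta$ is a minimizer of $J_\alpha^\delta(u)=\frac12\|Ku\|_Y^2-\langle Ku,f^\delta\rangle_{Z\times Z^*}+\alpha R(u)$, and $\mu_\alpha^\delta\in\partial R(u_\alpha^\delta)$ is the subgradient with $K^*(Ku_\alpha^\delta-f^\delta)+\alpha\mu_\alpha^\delta=0$. Standing assumption: there is a topology $\tau$ on $X$ in which $R$ is lower semicontinuous, sublevel sets of $R$ are sequentially compact, and $K:X\to Z$ is continuous. For $s>1$ let $J_s(u)=\{\mu\in X^*:\langle\mu,u\rangle=\|u\|_X\|\mu\|_{X^*},\ \|\mu\|_{X^*}=\|u\|_X^{s-1}\}$. $X$ is $s$-convex if there is $c_s>0$ with $\frac1s\|u-v\|_X^s\ge\frac1s\|u\|_X^s-\langle j,v\rangle+\frac{c_s}{s}\|v\|_X^s$ for all $u,v\in X$ and all $j\in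 J_s(u)$; $X$ is $s$-smooth if there is $G_s>0$ with $\frac1s\|u-v\|_X^s\le\frac1s\|u\|_X^s-\langle j,v\rangle+\frac{G_s}{s}\|v\|_X^s$ for all $u,v\in X$ and all $j\in J_s(u)$. The symmetric Bregman distance is $D_R^{\mu_u,\mu_v}(u,v)=\langle\mu_u-\mu_v,u-v\rangle_{X^*\times X}$ for $\mu_u\in\partial R(u)$, $\mu_v\in\partial R(v)$. $\alpha\simeq\delta^\kappa$ means $\alpha=\alpha(\delta)$ and $\delta^\kappa$ are bounded by $\delta$-independent constant multiples of each other; the bounds are for all sufficiently small $\delta>0$. *)

theory Defs
  imports "HOL-Analysis.Analysis" "HOL-Library.Landau_Symbols"
begin

text \<open>The dual of a real normed space \<open>'x\<close> is the type \<open>'x \<Rightarrow>\<^sub>L real\<close> with the operator norm;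
  the duality product is application.\<close>

section \<open>Geometry of Banach spaces\<close>

definition duality_map :: "real \<Rightarrow> 'x::real_normed_vector \<Rightarrow> ('x \<Rightarrow>\<^sub>L real) set" where
  "duality_map s u = {\<mu>. blinfun_apply \<mu> u = norm u * norm \<mu> \<and> norm \<mu> = norm u powr (s - 1)}"

definition s_convex_space :: "'x::real_normed_vector itself \<Rightarrow> real \<Rightarrow> bool" where
  "s_convex_space _ s \<longleftrightarrow> (\<exists>c>0. \<forall>(u::'x) v. \<forall>j\<in>duality_map s u.
     (1/s) * norm (u - v) powr s \<ge> (1/s) * norm u powr s - blinfun_apply j v + (c/s) * norm v powr s)"

definition s_smooth_space :: "'x::real_normed_vector itself \<Rightarrow> real \<Rightarrow> bool" where
  "s_smooth_space _ s \<longleftrightarrow> (\<exists>G>0. \<forall>(u::'x) v. \<forall>j\<in>duality_map s u.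
     (1/s) * norm (u - v) powr s \<le> (1/s) * norm u powr s - blinfun_apply j v + (G/s) * norm v powr s)"

section \<open>Convex functionals\<close>

definition subdifferential :: "('x::real_normed_vector \<Rightarrow> real) \<Rightarrow> 'x \<Rightarrow> ('x \<Rightarrow>\<^sub>L real) set" where
  "subdifferential R u = {\<mu>. \<forall>v. R v \<ge> R u + blinfun_apply \<mu> (v - u)}"

text \<open>The symmetric Bregman distance; meaningful for \<open>\<mu>\<^sub>u \<in> subdifferential R u\<close> and
  \<open>\<mu>\<^sub>v \<in> subdifferential R v\<close>, in which case \<open>R\<close> enters only through the subgradients.\<close>

definition sym_bregman ::
    "('x::real_normed_vector \<Rightarrow>\<^sub>L real) \<Rightarrow> ('x \<Rightarrow>\<^sub>L real) \<Rightarrow> 'x \<Rightarrow> 'x \<Rightarrow> real" where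
  "sym_bregman \<mu>\<^sub>u \<mu>\<^sub>v u v = blinfun_apply (\<mu>\<^sub>u - \<mu>\<^sub>v) (u - v)"

definition norm_power :: "real \<Rightarrow> 'x::real_normed_vector \<Rightarrow> real" where
  "norm_power p u = (1/p) * norm u powr p"

section \<open>Gelfand triple and the forward operator\<close>

text \<open>The inclusion of \<open>Z\<close> into \<open>Y\<close> is an injective linear map \<open>\<iota>\<close> with dense range. It is bounded,
  since every \<open>v \<in> Y\<close> is required to act continuously on \<open>Z\<close> by \<open>u \<mapsto> \<langle>u, v\<rangle>\<^sub>Y\<close>.\<close>

definition gelfand_inclusion :: "('z::banach \<Rightarrow>\<^sub>L 'y::{real_inner,complete_space}) \<Rightarrow> bool" where
  "gelfand_inclusion \<iota> \<longleftrightarrow> inj (blinfun_apply \<iota>) \<and> closure (range (blinfun_apply \<iota>)) = UNIV"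

text \<open>The inclusion of \<open>Y\<close> into \<open>Z\<^sup>*\<close>: \<open>v\<close> acts on \<open>Z\<close> by \<open>u \<mapsto> \<langle>v, \<iota> u\<rangle>\<^sub>Y\<close>.\<close>

definition pivot_to_dual ::
    "('z::real_normed_vector \<Rightarrow>\<^sub>L 'y::real_inner) \<Rightarrow> 'y \<Rightarrow> ('z \<Rightarrow>\<^sub>L real)" where
  "pivot_to_dual \<iota> v = blinfun_inner_right v o\<^sub>L \<iota>"

text \<open>The forward operator is given as a bounded map \<open>K\<close> into \<open>Z\<close>; as a map into \<open>Y\<close> it is
  \<open>\<iota> o\<^sub>L K\<close>. The extended adjoint \<open>K\<^sup>* : Z\<^sup>* \<rightarrow> X\<^sup>*\<close> is the transpose of \<open>K : X \<rightarrow> Z\<close>, and its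
  restriction to \<open>Y\<close> is \<open>v \<mapsto> (u \<mapsto> \<langle>v, \<iota> (K u)\<rangle>\<^sub>Y)\<close>.\<close>

definition ext_adjoint ::
    "('x::real_normed_vector \<Rightarrow>\<^sub>L 'z::real_normed_vector) \<Rightarrow> ('z \<Rightarrow>\<^sub>L real) \<Rightarrow> ('x \<Rightarrow>\<^sub>L real)" where
  "ext_adjoint K \<phi> = \<phi> o\<^sub>L K"

section \<open>Variational regularization\<close>

definition minimizing_solution ::
    "('x \<Rightarrow> real) \<Rightarrow> ('x::real_normed_vector \<Rightarrow>\<^sub>L 'y::real_normed_vector) \<Rightarrow> 'y \<Rightarrow> 'x \<Rightarrow> bool" where
  "minimizing_solution R A f u \<longleftrightarrow>
     blinfun_apply A u = f \<and> (\<forall>v. blinfun_apply A v = f \<longrightarrow> R u \<le> R v)"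

definition noisy_data ::
    "('z::real_normed_vector \<Rightarrow>\<^sub>L 'y::real_inner) \<Rightarrow> ('x::real_normed_vector \<Rightarrow>\<^sub>L 'z) \<Rightarrow> 'x \<Rightarrow>
     ('z \<Rightarrow>\<^sub>L real) \<Rightarrow> real \<Rightarrow> ('z \<Rightarrow>\<^sub>L real)" where
  "noisy_data \<iota> K u n \<delta> = pivot_to_dual \<iota> (blinfun_apply (\<iota> o\<^sub>L K) u) + \<delta> *\<^sub>R n"

definition reg_functional ::
    "('z::real_normed_vector \<Rightarrow>\<^sub>L 'y::real_inner) \<Rightarrow> ('x::real_normed_vector \<Rightarrow>\<^sub>L 'z) \<Rightarrow> ('x \<Rightarrow> real) \<Rightarrow>
     ('z \<Rightarrow>\<^sub>L real) \<Rightarrow> real \<Rightarrow> 'x \<Rightarrow> real" where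
  "reg_functional \<iota> K R g \<alpha> u =
     (1/2) * (norm (blinfun_apply (\<iota> o\<^sub>L K) u))\<^sup>2 - blinfun_apply g (blinfun_apply K u) + \<alpha> * R u"

definition regularized_solution ::
    "('z::real_normed_vector \<Rightarrow>\<^sub>L 'y::real_inner) \<Rightarrow> ('x::real_normed_vector \<Rightarrow>\<^sub>L 'z) \<Rightarrow> ('x \<Rightarrow> real) \<Rightarrow>
     ('z \<Rightarrow>\<^sub>L real) \<Rightarrow> real \<Rightarrow> 'x \<Rightarrow> ('x \<Rightarrow>\<^sub>L real) \<Rightarrow> bool" where
  "regularized_solution \<iota> K R g \<alpha> u \<mu> \<longleftrightarrow>
     (\<forall>v. reg_functional \<iota> K R g \<alpha> u \<le> reg_functional \<iota> K R g \<alpha> v) \<and>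
     \<mu> \<in> subdifferential R u \<and>
     ext_adjoint K (pivot_to_dual \<iota> (blinfun_apply (\<iota> o\<^sub>L K) u) - g) + \<alpha> *\<^sub>R \<mu> = 0"

definition seq_compact_in :: "'a topology \<Rightarrow> 'a set \<Rightarrow> bool" where
  "seq_compact_in T S \<longleftrightarrow> (\<forall>\<sigma>::nat \<Rightarrow> 'a. range \<sigma> \<subseteq> S \<longrightarrow>
     (\<exists>l\<in>S. \<exists>r. strict_mono r \<and> limitin T (\<sigma> \<circ> r) l sequentially))"

text \<open>\<open>T\<close> is an auxiliary topology on the underlying set of the Banach space, in general different
  from the norm topology; \<open>Z\<close> carries its norm topology.\<close>

definition admissible_topology ::
    "('x::real_normed_vector \<Rightarrow> real) \<Rightarrow> ('x \<Rightarrow>\<^sub>L 'z::real_normed_vector) \<Rightarrow> 'x topology \<Rightarrow> bool" where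
  "admissible_topology R K T \<longleftrightarrow>
     topspace T = UNIV \<and>
     (\<forall>a. openin T {u. R u > a}) \<and>
     (\<forall>a. seq_compact_in T {u. R u \<le> a}) \<and>
     continuous_map T euclidean (blinfun_apply K)"

section \<open>Approximate source conditions and exponents\<close>

definition approx_source_condition ::
    "('z::real_normed_vector \<Rightarrow>\<^sub>L 'y::real_inner) \<Rightarrow> ('x::real_normed_vector \<Rightarrow>\<^sub>L 'z) \<Rightarrow> real \<Rightarrow>
     real \<Rightarrow> real \<Rightarrow> ('x \<Rightarrow>\<^sub>L real) \<Rightarrow> bool" where
  "approx_source_condition \<iota> K q C r \<xi> \<longleftrightarrow> (\<forall>\<^sub>F \<beta> in at_right 0.
     (INF w. (1/\<beta>) * norm (ext_adjoint K (pivot_to_dual \<iota> w) - \<xi>) powr q + (1/2) * (norm w)\<^sup>2)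
       \<le> C * \<beta> powr (- r))"

definition nu :: "real \<Rightarrow> real \<Rightarrow> real" where
  "nu q r = 2 + r * (q - 2)"

definition kappa :: "real \<Rightarrow> real \<Rightarrow> real \<Rightarrow> real" where
  "kappa q r1 r2 =
     (if r1 \<le> r2 then nu q r1 * nu q r2 / (nu q r1 * nu q r2 + q * (r2 - r1)) else 1)"

definition rate_exponent :: "real \<Rightarrow> real \<Rightarrow> real \<Rightarrow> real" where
  "rate_exponent q r1 r2 =
     (if r1 \<le> r2 then 2 * nu q r2 * (1 - r1) / (nu q r1 * nu q r2 + q * (r2 - r1))
      else 2 * (1 - r1) / (2 + r1 * (q - 2)))"

end

theory Submission
  imports Defs
begin

text \<open>Write \<open>A\<close> for the forward operator into \<open>Y\<close> and \<open>d = u - u\<^sup>\<dagger>\<close>. The optimality condition,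
  tested with \<open>d\<close>, says
  \<open>\<parallel>A d\<parallel>\<^sup>2 + \<alpha> D = \<delta> \<langle>\<eta>, d\<rangle> - \<alpha> \<langle>\<mu>\<^sup>\<dagger>, d\<rangle>\<close>, where \<open>D\<close> is the symmetric Bregman distance. Split
  \<open>\<mu>\<^sup>\<dagger> = A\<^sup>* w\<^sub>1 - e\<^sub>1\<close> and \<open>\<eta> = A\<^sup>* w\<^sub>2 - e\<^sub>2\<close>. The parts in the range of \<open>A\<^sup>*\<close> pair with \<open>A d\<close> and are
  absorbed by \<open>\<parallel>A d\<parallel>\<^sup>2\<close>; the defects pair with \<open>d\<close> itself. This gives
  (\<open>sym_bregman_energy_estimate\<close>)

  \<open>D \<le> \<alpha> \<parallel>w\<^sub>1\<parallel>\<^sup>2 + (\<delta>/\<alpha>)\<^sup>2 \<alpha> \<parallel>w\<^sub>2\<parallel>\<^sup>2 + (\<parallel>e\<^sub>1\<parallel> + (\<delta>/\<alpha>) \<parallel>e\<^sub>2\<parallel>) \<parallel>d\<parallel>.\<close>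

  To absorb the last term one needs \<open>\<parallel>d\<parallel>\<^sup>2 \<le> const D\<close>. On bounded sets this follows from
  \<open>2\<close>-convexity, although \<open>R\<close> is a \<open>p\<close>-th power with \<open>p < 2\<close> (\<open>sym_bregman_ge_norm_diff\<close>): the
  Bregman distance of \<open>\<parallel>\<cdot>\<parallel>\<^sup>p / p\<close> controls the difference of the norms by one-dimensional
  monotonicity, and \<open>2\<close>-convexity controls the difference of the directions. The minimizers stay in
  a bounded set because \<open>D\<close> grows like \<open>\<parallel>u\<parallel>\<^sup>p\<close> with \<open>p > 1\<close>, while the right-hand side above is only
  linear in \<open>\<parallel>u\<parallel>\<close> (\<open>norm_le_of_sym_bregman_le\<close>). So \<open>D \<le> const \<cdot> E\<close>, where
  \<open>E = \<alpha> \<parallel>w\<^sub>1\<parallel>\<^sup>2 + \<parallel>e\<^sub>1\<parallel>\<^sup>2 + (\<delta>/\<alpha>)\<^sup>2 (\<alpha> \<parallel>w\<^sub>2\<parallel>\<^sup>2 + \<parallel>e\<^sub>2\<parallel>\<^sup>2)\<close>.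

  The source conditions leave the parameters \<open>\<beta>\<^sub>i\<close> free. With \<open>\<beta>\<^sub>i = \<alpha>\<^bsup>q/\<nu>\<^sub>i\<^esup>\<close> the two contributions
  \<open>\<alpha> \<parallel>w\<^sub>i\<parallel>\<^sup>2\<close> and \<open>\<parallel>e\<^sub>i\<parallel>\<^sup>2\<close> have the same order \<open>\<alpha>\<^bsup>\<sigma>\<^sub>i\<^esup>\<close>, where \<open>\<sigma>\<^sub>i = 2 (1 - r\<^sub>i) / \<nu>\<^sub>i\<close>
  (\<open>approx_source_decomposition\<close>). Hence \<open>D = O(\<alpha>\<^bsup>\<sigma>\<^sub>1\<^esup> + (\<delta>/\<alpha>)\<^sup>2 \<alpha>\<^bsup>\<sigma>\<^sub>2\<^esup>)\<close>. For \<open>r\<^sub>1 \<le> r\<^sub>2\<close> the exponent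
  \<open>\<kappa>\<close> is the one for which both terms have the same order in \<open>\<delta>\<close>; for \<open>r\<^sub>2 < r\<^sub>1\<close> and
  \<open>\<alpha> \<simeq> \<delta>\<close> the first term dominates (\<open>rate_exponents\<close>).

  Any larger constant is as good in the final estimate, so the maximum of the constant obtained for
  \<open>p\<close> and \<open>1 / (2 - p)\<close> is an admissible choice of \<open>C\<^sub>p\<close> and tends to infinity as \<open>p \<rightarrow> 2\<close>.\<close>

section \<open>Subgradients of powers of the norm\<close>

text \<open>The pairing \<open>\<langle>\<mu>, u\<rangle> = \<parallel>u\<parallel>\<^sup>p\<close> says that \<open>R - \<mu>\<close> has zero derivative at \<open>u\<close> along its ray. The bound on
  \<open>\<parallel>\<mu>\<parallel>\<close> comes from comparing \<open>u\<close> with the vector of the same norm in an arbitrary direction; for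
  \<open>u = 0\<close> the comparison is with short vectors instead, and \<open>p > 1\<close> forces \<open>\<mu> = 0\<close>.\<close>

lemma subdifferential_norm_power_subset_duality_map:
  assumes p: "1 < p" and mu: "\<mu> \<in> subdifferential (norm_power p) u"
  shows "\<mu> \<in> duality_map p u"
proof -
  define a where "a = norm u"
  have a0: "0 \<le> a" by (simp add: a_def)
  have sub: "a powr p / p + \<mu> v - \<mu> u \<le> norm v powr p / p" for v
    using mu by (auto simp: subdifferential_def norm_power_def a_def blinfun.diff_right
        dest: spec[of _ v])
  have pair: "\<mu> u = a powr p"
  proof (cases "a = 0")
    case True
    then show ?thesis by (simp add: a_def)
  next
    case False
    then have a: "0 < a" using a0 by simp
    define g where "g t = (t * a) powr p / p - t * \<mu> u" for t
    have "(g has_real_derivative (p * (1 * a) powr (p - 1) * a / p - \<mu> u)) (at 1)"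
      unfolding g_def using a p by (auto intro!: derivative_eq_intros)
    moreover have "g 1 \<le> g t" if "\<bar>1 - t\<bar> < 1" for t
    proof -
      have "0 < t" using that by linarith
      then show ?thesis
        using sub[of "t *\<^sub>R u"] by (simp add: g_def blinfun.scaleR_right a_def)
    qed
    ultimately have "p * (1 * a) powr (p - 1) * a / p - \<mu> u = 0"
      by (intro DERIV_local_min[of g _ 1 1]) auto
    then show ?thesis using a p by (simp add: powr_mult_base mult.commute)
  qed
  have le: "\<mu> h \<le> a powr (p - 1) * norm h" for h
  proof (cases "h = 0")
    case True
    then show ?thesis by simp
  next
    case h: False
    show ?thesis
    proof (cases "a = 0")
      case True
      have "\<mu> h \<le> t powr (p - 1) * (norm h powr p / p)" if "0 < t" for t
      proof -
        have "t * \<mu> h \<le> t * (t powr (p - 1) * (norm h powr p / p))"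
          using sub[of "t *\<^sub>R h"] that pair True
          by (simp add: blinfun.scaleR_right powr_mult powr_mult_base flip: mult.assoc)
        then show ?thesis using that by (simp only: mult_le_cancel_left_pos)
      qed
      then have "\<forall>\<^sub>F t in at_right 0. \<mu> h \<le> t powr (p - 1) * (norm h powr p / p)"
        by (auto simp: eventually_at_right_less eventually_at_right_field intro: exI[of _ 1])
      moreover have "((\<lambda>t. t powr (p - 1) * (norm h powr p / p)) \<longlongrightarrow> 0 powr (p - 1) * (norm h powr p / p))
          (at_right (0::real))"
        using p by (intro tendsto_mult tendsto_powr' tendsto_const tendsto_ident_at)
           (auto simp: eventually_at_right_field intro: exI[of _ 1])
      ultimately have "\<mu> h \<le> 0 powr (p - 1) * (norm h powr p / p)"
        by (intro tendsto_lowerbound) auto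
      then show ?thesis using True by simp
    next
      case False
      then have a: "0 < a" using a0 by simp
      have "(a / norm h) * \<mu> h \<le> a powr p"
        using sub[of "(a / norm h) *\<^sub>R h"] h a pair by (simp add: blinfun.scaleR_right)
      also have "a powr p = a * a powr (p - 1)" using a by (simp add: powr_mult_base)
      finally have "a * (\<mu> h / norm h) \<le> a * a powr (p - 1)" by simp
      then have "\<mu> h / norm h \<le> a powr (p - 1)" using a by (simp only: mult_le_cancel_left_pos)
      then show ?thesis using h by (simp add: divide_simps)
    qed
  qed
  have abs_le: "norm (\<mu> h) \<le> a powr (p - 1) * norm h" for h
    using le[of h] le[of "- h"] by (simp add: blinfun.minus_right abs_le_iff)
  have "norm \<mu> \<le> a powr (p - 1)"
    by (rule norm_blinfun_bound) (use abs_le in auto)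
  moreover have "a powr (p - 1) \<le> norm \<mu>"
  proof (cases "a = 0")
    case False
    then have a: "0 < a" using a0 by simp
    have "a * a powr (p - 1) \<le> a * norm \<mu>"
      using norm_blinfun[of \<mu> u] a pair by (simp add: powr_mult_base a_def mult.commute)
    then show ?thesis using a by simp
  qed simp
  ultimately have "norm \<mu> = a powr (p - 1)" by simp
  moreover have "a powr p = a * a powr (p - 1)" using a0 p by (simp add: powr_mult_base)
  ultimately show ?thesis using pair by (simp add: duality_map_def a_def)
qed

lemma sym_bregman_commute: "sym_bregman \<nu> \<mu> v u = sym_bregman \<mu> \<nu> u v"
  by (simp add: sym_bregman_def blinfun.diff_left blinfun.diff_right)

text \<open>The radial part of the Bregman distance separates from two angular parts, which measure how far
  the two functionals are from being aligned with the other vector. For \<open>p > 1\<close> all three are nonnegative.\<close>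

lemma sym_bregman_duality_map:
  assumes "\<mu> \<in> duality_map p u" "\<nu> \<in> duality_map p v"
  shows "sym_bregman \<mu> \<nu> u v = (norm u powr (p - 1) - norm v powr (p - 1)) * (norm u - norm v)
     + (norm u powr (p - 1) * norm v - \<mu> v) + (norm v powr (p - 1) * norm u - \<nu> u)"
  using assms by (simp add: sym_bregman_def duality_map_def blinfun.diff_left
      blinfun.diff_right algebra_simps)

lemma duality_map_apply_le:
  assumes "\<mu> \<in> duality_map p u"
  shows "\<mu> v \<le> norm u powr (p - 1) * norm v"
  using assms norm_blinfun[of \<mu> v] by (simp add: duality_map_def)

text \<open>Concavity of \<open>x \<mapsto> x\<^sup>t\<close> at \<open>a\<close>, obtained from Young's inequality for \<open>b\<^sup>t a\<^bsup>1-t\<^esup>\<close>.\<close>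

lemma powr_diff_ge_linear:
  fixes a b t :: real
  assumes "0 < t" "t < 1" "0 \<le> b" "b \<le> a"
  shows "t * a powr (t - 1) * (a - b) \<le> a powr t - b powr t"
proof (cases "a = 0")
  case True
  then show ?thesis using assms by simp
next
  case False
  then have a: "0 < a" using assms by simp
  have le: "b powr t * a powr (1 - t) \<le> t * b + (1 - t) * a"
    using Youngs_inequality_0[of t "1 - t" b a] assms a by (cases "b = 0") auto
  define z where "z = a powr (t - 1)"
  have 1: "a powr (1 - t) * z = 1" using a by (simp add: z_def flip: powr_add)
  have 2: "a powr t = a * z" using a by (simp add: z_def powr_mult_base)
  from le have "b powr t * a powr (1 - t) * z \<le> (t * b + (1 - t) * a) * z"
    by (rule mult_right_mono) (simp add: z_def)
  then have "b powr t \<le> (t * b + (1 - t) * a) * z" by (simp only: mult.assoc 1 mult_1_right)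
  then show ?thesis by (simp add: 2 algebra_simps flip: z_def)
qed

section \<open>Lower bounds for the Bregman distance\<close>

text \<open>The angular part that is kept is the one at the vector of larger norm: if the norms are
  comparable, \<open>2\<close>-convexity bounds it with the same weight \<open>\<parallel>u\<parallel>\<^bsup>p-2\<^esup>\<close> that the radial part carries.\<close>

lemma sym_bregman_ge_radial:
  assumes p: "1 < p" "p < 2" and le: "norm v \<le> norm u"
    and mu: "\<mu> \<in> duality_map p u" and nu: "\<nu> \<in> duality_map p v"
  shows "(p - 1) * norm u powr (p - 2) * (norm u - norm v)\<^sup>2
      + (norm u powr (p - 1) * norm v - \<mu> v) \<le> sym_bregman \<mu> \<nu> u v"
proof -
  have "(p - 1) * norm u powr (p - 1 - 1) * (norm u - norm v)
      \<le> norm u powr (p - 1) - norm v powr (p - 1)"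
    by (rule powr_diff_ge_linear) (use p le in auto)
  then have "(p - 1) * norm u powr (p - 1 - 1) * (norm u - norm v) * (norm u - norm v)
      \<le> (norm u powr (p - 1) - norm v powr (p - 1)) * (norm u - norm v)"
    by (rule mult_right_mono) (use le in simp)
  then show ?thesis
    using duality_map_apply_le[OF nu, of u]
    by (simp add: sym_bregman_duality_map[OF mu nu] power2_eq_square mult.assoc)
qed

text \<open>The convexity inequality at \<open>u\<close> is applied with \<open>v\<close> rescaled to the norm of \<open>u\<close>. The quadratic
  terms \<open>\<parallel>u\<parallel>\<^sup>2\<close> then cancel, and what remains bounds the angular part by the distance of the
  directions. The rescaling is what makes it possible to pass from the duality map of order \<open>2\<close> to
  that of order \<open>p\<close>: these differ by a factor that depends only on the norm.\<close>

lemma two_convex_rescaled: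
  fixes u v :: "'x::real_normed_vector"
  assumes conv: "\<And>(u::'x) v j. j \<in> duality_map 2 u \<Longrightarrow>
      (1/2) * norm u powr 2 - blinfun_apply j v + (c/2) * norm v powr 2 \<le> (1/2) * norm (u - v) powr 2"
    and u: "u \<noteq> 0" and v: "v \<noteq> 0" and mu: "\<mu> \<in> duality_map p u"
  shows "(c/2) * norm u powr (p - 3) * norm v * (norm (u - (norm u / norm v) *\<^sub>R v))\<^sup>2
      \<le> norm u powr (p - 1) * norm v - \<mu> v"
proof -
  define a b where "a = norm u" and "b = norm v"
  have a: "0 < a" and b: "0 < b" using u v by (auto simp: a_def b_def)
  define j where "j = a powr (2 - p) *\<^sub>R \<mu>"
  have mu': "\<mu> u = a * a powr (p - 1)" "norm \<mu> = a powr (p - 1)"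
    using mu by (auto simp: duality_map_def a_def)
  have pw: "a powr (2 - p) * a powr (p - 1) = a" using a by (simp flip: powr_add)
  have j: "j \<in> duality_map 2 u"
    using a mu' pw by (simp add: duality_map_def j_def blinfun.scaleR_left flip: a_def)
  define w where "w = u - (a / b) *\<^sub>R v"
  have ju: "j u = a\<^sup>2"
    using mu' pw by (simp add: j_def blinfun.scaleR_left power2_eq_square mult.left_commute)
  have "u - w = (a / b) *\<^sub>R v" by (simp add: w_def)
  then have nuw: "norm (u - w) = a" using a b by (simp add: b_def[symmetric])
  have "(1/2) * a\<^sup>2 - j w + (c/2) * (norm w)\<^sup>2 \<le> (1/2) * a\<^sup>2"
    using conv[OF j, of w] nuw a by (simp add: a_def)
  moreover have "j w = a\<^sup>2 - (a / b) * j v"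
    by (simp add: w_def blinfun.diff_right blinfun.scaleR_right ju)
  ultimately have "(c/2) * (norm w)\<^sup>2 \<le> a\<^sup>2 - (a / b) * (a powr (2 - p) * \<mu> v)"
    by (simp add: j_def blinfun.scaleR_left)
  then have "(a powr (p - 3) * b) * ((c/2) * (norm w)\<^sup>2)
      \<le> (a powr (p - 3) * b) * (a\<^sup>2 - (a / b) * (a powr (2 - p) * \<mu> v))"
    by (rule mult_left_mono) (use b in simp)
  also have "\<dots> = (a powr (p - 3) * a\<^sup>2) * b - (a powr (p - 3) * a * a powr (2 - p)) * \<mu> v"
    using b by (simp add: field_simps)
  also have "a powr (p - 3) * a\<^sup>2 = a powr (p - 1)"
    using a by (simp flip: powr_numeral powr_add)
  also have "a powr (p - 3) * a * a powr (2 - p) = a powr ((p - 3) + 1 + (2 - p))"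
    using a by (simp only: powr_add powr_one)
  also have "\<dots> = 1" using a by simp
  finally show ?thesis by (simp add: w_def a_def b_def mult_ac)
qed

text \<open>If \<open>\<parallel>v\<parallel> \<le> \<parallel>u\<parallel> / 2\<close>, the radial part alone dominates \<open>\<parallel>u - v\<parallel>\<^sup>2\<close>. Otherwise the norms are
  comparable and \<open>u - v\<close> splits into a difference of equally long vectors, bounded by the angular
  part, and a radial difference.\<close>

lemma sym_bregman_ge_norm_diff_ordered:
  fixes u v :: "'x::real_normed_vector"
  assumes p: "1 < p" "p < 2" and c: "0 < c"
    and conv: "\<And>(u::'x) v j. j \<in> duality_map 2 u \<Longrightarrow>
      (1/2) * norm u powr 2 - blinfun_apply j v + (c/2) * norm v powr 2 \<le> (1/2) * norm (u - v) powr 2"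
    and mu: "\<mu> \<in> duality_map p u" and nu: "\<nu> \<in> duality_map p v"
    and le: "norm v \<le> norm u"
  shows "min ((p - 1) / 16) (c / 8) * norm u powr (p - 2) * (norm (u - v))\<^sup>2 \<le> sym_bregman \<mu> \<nu> u v"
proof (cases "u = 0")
  case True
  then show ?thesis using le by (simp add: sym_bregman_def blinfun.zero_right)
next
  case u: False
  define a b k where "a = norm u" and "b = norm v" and "k = min ((p - 1) / 16) (c / 8)"
  have a: "0 < a" and b: "0 \<le> b" "b \<le> a" using u le by (auto simp: a_def b_def)
  have k: "0 < k" "16 * k \<le> p - 1" "8 * k \<le> c" using p c by (auto simp: k_def min_def)
  have rad: "(p - 1) * a powr (p - 2) * (a - b)\<^sup>2 + (a powr (p - 1) * b - \<mu> v) \<le> sym_bregman \<mu> \<nu> u v"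
    using sym_bregman_ge_radial[OF p le mu nu] by (simp add: a_def b_def)
  show ?thesis
  proof (cases "b \<le> a / 2")
    case True
    have "norm (u - v) \<le> a + b" unfolding a_def b_def by (rule norm_triangle_ineq4)
    also have "\<dots> \<le> 3 * (a - b)" using True by simp
    finally have "(norm (u - v))\<^sup>2 \<le> (3 * (a - b))\<^sup>2" by (rule power_mono) simp
    then have "(norm (u - v))\<^sup>2 \<le> 9 * (a - b)\<^sup>2" by (simp only: power_mult_distrib) simp
    then have "k * (norm (u - v))\<^sup>2 \<le> k * (9 * (a - b)\<^sup>2)" using k by simp
    also have "\<dots> \<le> (p - 1) * (a - b)\<^sup>2"
      using mult_right_mono[of "9 * k" "p - 1" "(a - b)\<^sup>2"] k by simp
    finally have "a powr (p - 2) * (k * (norm (u - v))\<^sup>2) \<le> a powr (p - 2) * ((p - 1) * (a - b)\<^sup>2)"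
      by (rule mult_left_mono) simp
    then show ?thesis
      using rad duality_map_apply_le[OF mu, of v] by (simp add: k_def a_def b_def mult_ac)
  next
    case False
    then have b0: "0 < b" and half: "a / 2 \<le> b" using a by auto
    then have v: "v \<noteq> 0" by (auto simp: b_def)
    \<comment> \<open>The length of the angular component of \<open>u - v\<close>; the radial one has length \<open>a - b\<close>.\<close>
    define x where "x = norm (u - (a / b) *\<^sub>R v)"
    have tw: "(c/2) * a powr (p - 3) * b * x\<^sup>2 \<le> a powr (p - 1) * b - \<mu> v"
      using two_convex_rescaled[OF conv u v mu] by (simp add: a_def b_def x_def)
    have e3: "a powr (p - 3) * a = a powr (p - 2)"
      using a powr_mult_base[of a "p - 3"] by (simp add: mult.commute)
    have "(c/4) * a powr (p - 2) * x\<^sup>2 = (c/2) * a powr (p - 3) * (a / 2) * x\<^sup>2"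
      by (simp flip: e3)
    also have "\<dots> \<le> (c/2) * a powr (p - 3) * b * x\<^sup>2"
      using half c by (intro mult_right_mono mult_left_mono) auto
    finally have low: "(p - 1) * a powr (p - 2) * (a - b)\<^sup>2 + (c/4) * a powr (p - 2) * x\<^sup>2
        \<le> sym_bregman \<mu> \<nu> u v" using tw rad by linarith
    have "norm (u - v) = norm ((u - (a / b) *\<^sub>R v) + (a / b - 1) *\<^sub>R v)"
      by (simp add: algebra_simps)
    also have "\<dots> \<le> x + norm ((a / b - 1) *\<^sub>R v)"
      unfolding x_def by (rule norm_triangle_ineq)
    also have "norm ((a / b - 1) *\<^sub>R v) = a - b"
      using b b0 by (simp add: b_def[symmetric] field_simps)
    finally have "(norm (u - v))\<^sup>2 \<le> (x + (a - b))\<^sup>2" by (rule power_mono) simp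
    also have "\<dots> \<le> 2 * (a - b)\<^sup>2 + 2 * x\<^sup>2"
      using sum_squares_bound[of x "a - b"] by (simp add: power2_sum)
    finally have "k * (norm (u - v))\<^sup>2 \<le> k * (2 * (a - b)\<^sup>2 + 2 * x\<^sup>2)" using k by simp
    also have "\<dots> \<le> (p - 1) * (a - b)\<^sup>2 + (c/4) * x\<^sup>2"
      using mult_right_mono[of "2 * k" "p - 1" "(a - b)\<^sup>2"] mult_right_mono[of "2 * k" "c / 4" "x\<^sup>2"] k
      by (simp add: algebra_simps)
    finally have "a powr (p - 2) * (k * (norm (u - v))\<^sup>2)
        \<le> a powr (p - 2) * ((p - 1) * (a - b)\<^sup>2 + (c/4) * x\<^sup>2)"
      by (rule mult_left_mono) simp
    then show ?thesis using low by (simp add: k_def a_def algebra_simps)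
  qed
qed

lemma sym_bregman_ge_norm_diff:
  fixes u v :: "'x::real_normed_vector"
  assumes p: "1 < p" "p < 2" and c: "0 < c"
    and conv: "\<And>(u::'x) v j. j \<in> duality_map 2 u \<Longrightarrow>
      (1/2) * norm u powr 2 - blinfun_apply j v + (c/2) * norm v powr 2 \<le> (1/2) * norm (u - v) powr 2"
    and mu: "\<mu> \<in> duality_map p u" and nu: "\<nu> \<in> duality_map p v"
    and M: "norm u \<le> M" "norm v \<le> M"
  shows "min ((p - 1) / 16) (c / 8) * M powr (p - 2) * (norm (u - v))\<^sup>2 \<le> sym_bregman \<mu> \<nu> u v"
proof -
  have *: "min ((p - 1) / 16) (c / 8) * M powr (p - 2) * (norm (u - v))\<^sup>2 \<le> sym_bregman \<mu> \<nu> u v"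
    if le: "norm v \<le> norm u" and mu: "\<mu> \<in> duality_map p u" and nu: "\<nu> \<in> duality_map p v"
      and M: "norm u \<le> M" for u v :: 'x and \<mu> \<nu>
  proof (cases "u = 0")
    case True
    then show ?thesis using le by (simp add: sym_bregman_def blinfun.zero_right)
  next
    case False
    then have "M powr (p - 2) \<le> norm u powr (p - 2)"
      using M p by (intro powr_mono2') auto
    then have "min ((p - 1) / 16) (c / 8) * M powr (p - 2) * (norm (u - v))\<^sup>2
        \<le> min ((p - 1) / 16) (c / 8) * norm u powr (p - 2) * (norm (u - v))\<^sup>2"
      using p c by (intro mult_right_mono mult_left_mono) auto
    then show ?thesis
      using sym_bregman_ge_norm_diff_ordered[OF p c conv mu nu le] by linarith
  qed
  show ?thesis
  proof (cases "norm v \<le> norm u")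
    case True
    then show ?thesis using * mu nu M by blast
  next
    case False
    then show ?thesis
      using *[of u v \<nu> \<mu>] mu nu M by (simp add: sym_bregman_commute norm_minus_commute)
  qed
qed


text \<open>For \<open>\<parallel>u\<parallel> \<ge> 2 \<parallel>v\<parallel>\<close> the radial part is at least \<open>(p - 1) \<parallel>u\<parallel>\<^sup>p / 4\<close>, which exceeds every
  function of linear growth once \<open>\<parallel>u\<parallel>\<close> is large.\<close>

lemma norm_le_of_sym_bregman_le:
  fixes u v :: "'x::real_normed_vector"
  assumes p: "1 < p" "p < 2"
    and mu: "\<mu> \<in> duality_map p u" and nu: "\<nu> \<in> duality_map p v"
    and B: "0 \<le> B" and E: "0 \<le> E"
    and D: "sym_bregman \<mu> \<nu> u v \<le> B + E * norm (u - v)"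
  shows "norm u \<le> max (max 1 (2 * norm v)) ((4 * (B + 3 / 2 * E) / (p - 1)) powr (1 / (p - 1)))"
proof (rule ccontr)
  define a b X where "a = norm u" and "b = norm v" and "X = 4 * (B + 3 / 2 * E) / (p - 1)"
  assume "\<not> ?thesis"
  then have a: "1 < a" "2 * b < a" and aX: "X powr (1 / (p - 1)) < a"
    by (auto simp: a_def b_def X_def not_le)
  have b: "0 \<le> b" and X: "0 \<le> X" using p B E by (auto simp: b_def X_def)
  have "X = (X powr (1 / (p - 1))) powr (p - 1)" using X p by (simp add: powr_powr)
  also have "\<dots> < a powr (p - 1)" using aX p by (intro powr_less_mono2) auto
  finally have Xa: "X < a powr (p - 1)" .
  have "(p - 1) / 4 * (a powr (p - 1) * a) = (p - 1) * a powr (p - 2) * (a / 2)\<^sup>2"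
    using a powr_mult_base[of a "p - 2"] by (simp add: power2_eq_square mult.commute)
  also have "\<dots> \<le> (p - 1) * a powr (p - 2) * (a - b)\<^sup>2"
    using a b p by (intro mult_left_mono power_mono) auto
  also have "\<dots> \<le> sym_bregman \<mu> \<nu> u v"
    using sym_bregman_ge_radial[OF p _ mu nu] duality_map_apply_le[OF mu, of v] a b
    by (force simp: a_def b_def)
  also have "\<dots> \<le> B + E * (3 / 2 * a)"
  proof -
    have "norm (u - v) \<le> a + b" unfolding a_def b_def by (rule norm_triangle_ineq4)
    also have "\<dots> \<le> 3 / 2 * a" using a by simp
    finally show ?thesis using D mult_left_mono[OF _ E] by fastforce
  qed
  also have "\<dots> \<le> (B + 3 / 2 * E) * a"
    using mult_left_mono[of 1 a B] a B by (simp add: algebra_simps)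
  finally have "(p - 1) / 4 * a powr (p - 1) * a \<le> (B + 3 / 2 * E) * a" by (simp add: mult_ac)
  then have "(p - 1) / 4 * a powr (p - 1) \<le> B + 3 / 2 * E" using a by simp
  then have "a powr (p - 1) \<le> X" using p by (simp add: X_def field_simps)
  then show False using Xa by simp
qed

section \<open>Energy estimate under approximate source conditions\<close>

text \<open>With \<open>e = A\<^sup>* w - \<xi>\<close>, the source condition at \<open>\<beta>\<close> yields \<open>\<parallel>e\<parallel>\<^sup>q = O(\<beta>\<^bsup>1-r\<^esup>)\<close> and \<open>\<parallel>w\<parallel>\<^sup>2 = O(\<beta>\<^bsup>-r\<^esup>)\<close>. The choice
  \<open>\<beta> = a\<^bsup>q/\<nu>\<^esup>\<close> equalizes the orders of \<open>\<parallel>e\<parallel>\<^sup>2\<close> and \<open>a \<parallel>w\<parallel>\<^sup>2\<close>, since \<open>1 - q r / \<nu> = 2 (1 - r) / \<nu>\<close>.\<close>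

lemma approx_source_decomposition:
  fixes \<iota> :: "'z::real_normed_vector \<Rightarrow>\<^sub>L 'y::real_inner" and K :: "'x::real_normed_vector \<Rightarrow>\<^sub>L 'z"
  assumes src: "approx_source_condition \<iota> K q C r \<xi>" and q: "2 < q" and r: "0 \<le> r"
  obtains G where "0 < G"
    "\<forall>\<^sub>F a in at_right 0. \<exists>w.
       (norm (ext_adjoint K (pivot_to_dual \<iota> w) - \<xi>))\<^sup>2 \<le> G * a powr (2 * (1 - r) / nu q r) \<and>
       a * (norm w)\<^sup>2 \<le> G * a powr (2 * (1 - r) / nu q r)"
proof -
  define \<nu> where "\<nu> = nu q r"
  have nu: "0 < \<nu>" using q r by (auto simp: \<nu>_def nu_def intro: add_pos_nonneg)
  have expo: "1 - q * r / \<nu> = 2 * (1 - r) / \<nu>"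
    using nu by (simp add: field_simps) (simp add: \<nu>_def nu_def algebra_simps)
  define F where "F w = norm (ext_adjoint K (pivot_to_dual \<iota> w) - \<xi>)" for w
  \<comment> \<open>The infimum need not be attained; a constant strictly above \<open>C\<close> leaves room for a near-minimizer.\<close>
  define S where "S = \<bar>C\<bar> + 1"
  have S: "0 < S" "C < S" by (auto simp: S_def)
  define G where "G = max (S powr (2 / q)) (2 * S)"
  have lim: "filterlim (\<lambda>a::real. a powr (q / \<nu>)) (at_right 0) (at_right 0)"
  proof (rule filterlim_at_withinI)
    show "((\<lambda>a::real. a powr (q / \<nu>)) \<longlongrightarrow> 0) (at_right 0)"
      using tendsto_powr'[of "\<lambda>a::real. a" 0 "at_right 0" "\<lambda>_. q / \<nu>" "q / \<nu>"] q nu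
      by (auto simp: eventually_at_right_field intro: exI[of _ 1])
    show "\<forall>\<^sub>F a::real in at_right 0. a powr (q / \<nu>) \<in> {0<..} - {0}"
      by (auto simp: eventually_at_right_field intro: exI[of _ 1])
  qed
  have "\<forall>\<^sub>F \<beta> in at_right 0. (INF w. (1/\<beta>) * F w powr q + (1/2) * (norm w)\<^sup>2) \<le> C * \<beta> powr (- r)"
    using src by (simp add: approx_source_condition_def F_def)
  from eventually_compose_filterlim[OF this lim]
  have "\<forall>\<^sub>F a in at_right 0. (INF w. (1 / a powr (q / \<nu>)) * F w powr q + (1/2) * (norm w)\<^sup>2)
      \<le> C * (a powr (q / \<nu>)) powr (- r)" .
  moreover have "\<forall>\<^sub>F a::real in at_right 0. 0 < a" by (rule eventually_at_right_less)
  ultimately have "\<forall>\<^sub>F a in at_right 0. \<exists>w. (F w)\<^sup>2 \<le> G * a powr (2 * (1 - r) / \<nu>) \<and>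
       a * (norm w)\<^sup>2 \<le> G * a powr (2 * (1 - r) / \<nu>)"
  proof eventually_elim
    case (elim a)
    define \<beta> where "\<beta> = a powr (q / \<nu>)"
    have \<beta>: "0 < \<beta>" using elim by (simp add: \<beta>_def)
    have "(INF w. (1/\<beta>) * F w powr q + (1/2) * (norm w)\<^sup>2) < S * \<beta> powr (- r)"
      using elim(1) unfolding \<beta>_def[symmetric]
      by (rule le_less_trans) (use S \<beta> in simp)
    moreover have "bdd_below (range (\<lambda>w. (1/\<beta>) * F w powr q + (1/2) * (norm w)\<^sup>2))"
      using \<beta> by (intro bdd_belowI[of _ 0]) auto
    ultimately obtain w where w: "(1/\<beta>) * F w powr q + (1/2) * (norm w)\<^sup>2 < S * \<beta> powr (- r)"
      by (subst (asm) cINF_less_iff) auto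
    have "(1/\<beta>) * F w powr q \<ge> 0" using \<beta> by simp
    then have w2: "(norm w)\<^sup>2 \<le> 2 * S * \<beta> powr (- r)" using w by linarith
    have "(1/\<beta>) * F w powr q \<le> S * \<beta> powr (- r)" using w zero_le_power2[of "norm w"] by linarith
    then have "F w powr q \<le> S * (\<beta> * \<beta> powr (- r))" using \<beta> by (simp add: field_simps)
    also have "\<beta> * \<beta> powr (- r) = \<beta> powr (1 - r)" using \<beta> by (simp add: powr_mult_base)
    finally have "(F w powr q) powr (2 / q) \<le> (S * \<beta> powr (1 - r)) powr (2 / q)"
      using q by (intro powr_mono2) auto
    moreover have "(F w powr q) powr (2 / q) = (F w)\<^sup>2"
      using q by (simp add: powr_powr F_def)
    moreover have "(S * \<beta> powr (1 - r)) powr (2 / q) = S powr (2 / q) * a powr (2 * (1 - r) / \<nu>)"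
      using q S by (simp add: powr_mult powr_powr \<beta>_def mult_ac)
    ultimately have "(F w)\<^sup>2 \<le> S powr (2 / q) * a powr (2 * (1 - r) / \<nu>)" by simp
    also have "\<dots> \<le> G * a powr (2 * (1 - r) / \<nu>)"
      by (intro mult_right_mono) (auto simp: G_def)
    finally have F: "(F w)\<^sup>2 \<le> G * a powr (2 * (1 - r) / \<nu>)" .
    have "a * (norm w)\<^sup>2 \<le> 2 * S * (a * \<beta> powr (- r))"
      using mult_left_mono[OF w2, of a] elim by (simp add: mult_ac)
    also have "a * \<beta> powr (- r) = a powr (1 - q * r / \<nu>)"
      using elim by (simp add: \<beta>_def powr_powr powr_mult_base)
    also have "2 * S * \<dots> \<le> G * a powr (1 - q * r / \<nu>)"
      by (intro mult_right_mono) (auto simp: G_def)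
    finally show ?case using F expo by auto
  qed
  moreover have "0 < G" using S by (simp add: G_def less_max_iff_disj)
  ultimately show ?thesis using that[of G] by (simp add: F_def \<nu>_def)
qed

text \<open>The optimality condition is tested with \<open>u - v\<close>. The inner products of \<open>w1\<close> and \<open>w2\<close> with
  \<open>A (u - v)\<close> are absorbed by \<open>\<parallel>A (u - v)\<parallel>\<^sup>2\<close>, at the price of \<open>\<parallel>w1\<parallel>\<^sup>2\<close> and \<open>\<parallel>w2\<parallel>\<^sup>2\<close>; for the defects only
  the norm of \<open>u - v\<close> in the Banach space is available.\<close>

lemma sym_bregman_energy_estimate:
  fixes \<iota> :: "'z::real_normed_vector \<Rightarrow>\<^sub>L 'y::real_inner" and K :: "'x::real_normed_vector \<Rightarrow>\<^sub>L 'z"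
  assumes opt: "ext_adjoint K (pivot_to_dual \<iota> (blinfun_apply (\<iota> o\<^sub>L K) u) - noisy_data \<iota> K v n \<delta>)
      + \<alpha> *\<^sub>R \<mu> = 0"
    and \<alpha>: "0 < \<alpha>" and \<delta>: "0 \<le> \<delta>"
  shows "sym_bregman \<mu> \<nu> u v \<le> \<alpha> * (norm w1)\<^sup>2 + (\<delta> / \<alpha>)\<^sup>2 * (\<alpha> * (norm w2)\<^sup>2)
    + (norm (ext_adjoint K (pivot_to_dual \<iota> w1) - \<nu>)
       + \<delta> / \<alpha> * norm (ext_adjoint K (pivot_to_dual \<iota> w2) - ext_adjoint K n)) * norm (u - v)"
proof -
  define d where "d = u - v"
  define y where "y = \<iota> (K d)"
  define e1 where "e1 = ext_adjoint K (pivot_to_dual \<iota> w1) - \<nu>"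
  define e2 where "e2 = ext_adjoint K (pivot_to_dual \<iota> w2) - ext_adjoint K n"
  have piv: "ext_adjoint K (pivot_to_dual \<iota> w) d = inner w y" for w
    by (simp add: ext_adjoint_def pivot_to_dual_def y_def)
  have "(ext_adjoint K (pivot_to_dual \<iota> (blinfun_apply (\<iota> o\<^sub>L K) u) - noisy_data \<iota> K v n \<delta>)
      + \<alpha> *\<^sub>R \<mu>) d = 0" unfolding opt by simp
  then have "inner y y - \<delta> * ext_adjoint K n d + \<alpha> * \<mu> d = 0"
    by (simp add: noisy_data_def ext_adjoint_def pivot_to_dual_def y_def d_def
        blinfun.add_left blinfun.diff_left blinfun.scaleR_left blinfun.diff_right
        inner_diff_left inner_diff_right inner_commute algebra_simps)
  then have "\<alpha> * \<mu> d = \<delta> * ext_adjoint K n d - inner y y" by simp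
  moreover have "\<nu> d = inner w1 y - e1 d" "ext_adjoint K n d = inner w2 y - e2 d"
    by (auto simp: e1_def e2_def blinfun.diff_left piv)
  moreover have "sym_bregman \<mu> \<nu> u v = \<mu> d - \<nu> d" "\<alpha> * (\<mu> d - \<nu> d) = \<alpha> * \<mu> d - \<alpha> * \<nu> d"
    by (auto simp: sym_bregman_def d_def blinfun.diff_left right_diff_distrib)
  ultimately have eq: "\<alpha> * sym_bregman \<mu> \<nu> u v
      = inner (\<delta> *\<^sub>R w2 - \<alpha> *\<^sub>R w1) y - inner y y + \<alpha> * e1 d - \<delta> * e2 d"
    by (simp only: inner_diff_left inner_scaleR_left right_diff_distrib)
  \<comment> \<open>Young's inequality: \<open>\<langle>z, y\<rangle> - \<parallel>y\<parallel>\<^sup>2 \<le> \<parallel>z\<parallel>\<^sup>2 / 4\<close> for \<open>z = \<delta> w\<^sub>2 - \<alpha> w\<^sub>1\<close>.\<close>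
  have "0 \<le> inner (\<delta> *\<^sub>R w2 - \<alpha> *\<^sub>R w1 - 2 *\<^sub>R y) (\<delta> *\<^sub>R w2 - \<alpha> *\<^sub>R w1 - 2 *\<^sub>R y)" by simp
  moreover have "0 \<le> inner (\<delta> *\<^sub>R w2 + \<alpha> *\<^sub>R w1) (\<delta> *\<^sub>R w2 + \<alpha> *\<^sub>R w1)" by simp
  moreover have "0 \<le> inner (\<delta> *\<^sub>R w2) (\<delta> *\<^sub>R w2)" "0 \<le> inner (\<alpha> *\<^sub>R w1) (\<alpha> *\<^sub>R w1)"
    by (rule inner_ge_zero)+
  ultimately have "inner (\<delta> *\<^sub>R w2 - \<alpha> *\<^sub>R w1) y - inner y y
      \<le> \<delta>\<^sup>2 * (norm w2)\<^sup>2 + \<alpha>\<^sup>2 * (norm w1)\<^sup>2"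
    unfolding power2_norm_eq_inner
    by (simp add: inner_diff_left inner_diff_right inner_add_left inner_add_right
        inner_commute power2_eq_square algebra_simps)
  moreover have "\<alpha> * e1 d \<le> \<alpha> * (norm e1 * norm d)"
    using norm_blinfun[of e1 d] \<alpha> by (intro mult_left_mono) auto
  moreover have "\<delta> * (- e2 d) \<le> \<delta> * (norm e2 * norm d)"
    using norm_blinfun[of e2 d] \<delta> by (intro mult_left_mono) auto
  ultimately have "\<alpha> * sym_bregman \<mu> \<nu> u v \<le> \<delta>\<^sup>2 * (norm w2)\<^sup>2 + \<alpha>\<^sup>2 * (norm w1)\<^sup>2
      + \<alpha> * (norm e1 * norm d) + \<delta> * (norm e2 * norm d)"
    unfolding eq by linarith
  also have "\<dots> = \<alpha> * (\<alpha> * (norm w1)\<^sup>2 + (\<delta> / \<alpha>)\<^sup>2 * (\<alpha> * (norm w2)\<^sup>2)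
      + (norm e1 + \<delta> / \<alpha> * norm e2) * norm d)"
    using \<alpha> by (simp add: field_simps power2_eq_square)
  finally show ?thesis using \<alpha> by (simp add: e1_def e2_def d_def)
qed

lemma absorb_linear_term:
  fixes D E m x :: real
  assumes "0 < m" "0 \<le> E" "m * x\<^sup>2 \<le> D" "D \<le> E + sqrt (2 * E) * x"
  shows "D \<le> 2 * (1 + 1 / m) * E"
proof -
  have "0 \<le> (sqrt (2 * E) - m * x)\<^sup>2" by simp
  then have "2 * m * (sqrt (2 * E) * x) \<le> 2 * E + m * (m * x\<^sup>2)"
    using assms by (simp add: power2_diff power_mult_distrib power2_eq_square algebra_simps)
  also have "\<dots> \<le> 2 * E + m * D" using assms by simp
  finally have "sqrt (2 * E) * x \<le> E / m + D / 2" using assms by (simp add: field_simps)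
  then have "D / 2 \<le> E + E / m" using assms by linarith
  then show ?thesis by (simp add: algebra_simps)
qed

section \<open>Choice of the regularization parameter\<close>

lemma nu_ge_2: "2 < q \<Longrightarrow> 0 \<le> r \<Longrightarrow> 2 \<le> nu q r"
  by (simp add: nu_def)

text \<open>The two terms \<open>\<alpha>\<^bsup>\<sigma>1\<^esup>\<close> and \<open>(\<delta>/\<alpha>)\<^sup>2 \<alpha>\<^bsup>\<sigma>2\<^esup>\<close> have the orders \<open>\<kappa> \<sigma>1\<close> and \<open>2 + \<kappa> (\<sigma>2 - 2)\<close> in \<open>\<delta>\<close>. For
  \<open>r1 \<le> r2\<close> they agree, by \<open>r2 \<nu>1 - r1 \<nu>2 = 2 (r2 - r1)\<close>; for \<open>r2 < r1\<close> the second is larger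
  because \<open>r \<mapsto> 2 (1 - r) / (2 + r (q - 2))\<close> is decreasing.\<close>

lemma rate_exponents:
  assumes q: "2 < q" and r: "0 \<le> r1" "r1 < 1" "0 \<le> r2"
  defines "\<sigma>1 \<equiv> 2 * (1 - r1) / nu q r1" and "\<sigma>2 \<equiv> 2 * (1 - r2) / nu q r2"
  shows "0 < kappa q r1 r2" "0 < \<sigma>1" "\<sigma>2 \<le> 1"
    "kappa q r1 r2 * \<sigma>1 = rate_exponent q r1 r2"
    "rate_exponent q r1 r2 \<le> 2 + kappa q r1 r2 * (\<sigma>2 - 2)"
    "0 \<le> rate_exponent q r1 r2"
proof -
  define x y where "x = nu q r1" and "y = nu q r2"
  have x: "2 \<le> x" and y: "2 \<le> y" using nu_ge_2[OF q] r by (auto simp: x_def y_def)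
  show s1: "0 < \<sigma>1" using x r by (simp add: \<sigma>1_def flip: x_def)
  have "0 \<le> r2 * q" using q r by simp
  then have "2 * (1 - r2) \<le> y" by (simp add: y_def nu_def algebra_simps)
  then show "\<sigma>2 \<le> 1" using y by (simp add: \<sigma>2_def flip: y_def)
  define N where "N = x * y + q * (r2 - r1)"
  have N: "0 < N" if "r1 \<le> r2"
    using that x y q by (simp add: N_def add_pos_nonneg)
  show k: "0 < kappa q r1 r2"
    using N x y by (simp add: kappa_def flip: x_def y_def N_def)
  show re: "kappa q r1 r2 * \<sigma>1 = rate_exponent q r1 r2"
    using x y by (simp add: kappa_def rate_exponent_def \<sigma>1_def nu_def[symmetric] flip: x_def y_def)
  show "0 \<le> rate_exponent q r1 r2" using k s1 by (simp flip: re)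
  show "rate_exponent q r1 r2 \<le> 2 + kappa q r1 r2 * (\<sigma>2 - 2)"
  proof (cases "r1 \<le> r2")
    case True
    have "2 + kappa q r1 r2 * (\<sigma>2 - 2) = (2 * N + x * (2 * (1 - r2) - 2 * y)) / N"
      using True x y N by (simp add: kappa_def \<sigma>2_def flip: x_def y_def N_def) (simp add: field_simps)
    also have "2 * N + x * (2 * (1 - r2) - 2 * y) = 2 * y * (1 - r1)"
      by (simp add: N_def x_def y_def nu_def algebra_simps)
    finally show ?thesis using True by (simp add: rate_exponent_def flip: x_def y_def N_def)
  next
    case False
    have "(1 - r1) * y \<le> (1 - r2) * x"
      using False q mult_right_mono[of r2 r1 q] by (simp add: x_def y_def nu_def algebra_simps)
    then have "2 * (1 - r1) / x \<le> 2 * (1 - r2) / y" using x y by (simp add: field_simps)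
    then show ?thesis
      using False by (simp add: kappa_def rate_exponent_def \<sigma>2_def nu_def[symmetric] flip: x_def y_def)
  qed
qed

text \<open>The exponent \<open>s2 - 2\<close> of \<open>\<alpha>\<close> in the second term is negative. This is where the lower bound on
  \<open>\<alpha>\<close> enters; the upper bound is used for the first term and for \<open>\<alpha> \<rightarrow> 0\<close>.\<close>

lemma parameter_choice_balances:
  fixes \<alpha> :: "real \<Rightarrow> real"
  assumes \<alpha>: "\<alpha> \<in> \<Theta>[at_right 0](\<lambda>\<delta>. \<delta> powr \<kappa>)" and pos: "\<And>\<delta>. 0 < \<delta> \<Longrightarrow> 0 < \<alpha> \<delta>"
    and \<kappa>: "0 < \<kappa>" and s: "0 < s1" "s2 \<le> 1"
    and rate: "\<kappa> * s1 = \<rho>" "\<rho> \<le> 2 + \<kappa> * (s2 - 2)"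
  obtains H where "0 < H" "filterlim \<alpha> (at_right 0) (at_right 0)"
    "\<forall>\<^sub>F \<delta> in at_right 0. \<alpha> \<delta> powr s1 + (\<delta> / \<alpha> \<delta>)\<^sup>2 * \<alpha> \<delta> powr s2 \<le> H * \<delta> powr \<rho>"
proof -
  obtain c2 where c2: "0 < c2" "\<forall>\<^sub>F \<delta> in at_right 0. norm (\<alpha> \<delta>) \<le> c2 * norm (\<delta> powr \<kappa>)"
    using bigthetaD1[OF \<alpha>] by (elim landau_o.bigE)
  obtain c1 where c1: "0 < c1" "\<forall>\<^sub>F \<delta> in at_right 0. norm (\<alpha> \<delta>) \<ge> c1 * norm (\<delta> powr \<kappa>)"
    using bigthetaD2[OF \<alpha>] by (elim landau_omega.bigE)
  have small: "\<forall>\<^sub>F \<delta>::real in at_right 0. 0 < \<delta> \<and> \<delta> < 1"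
    by (auto simp: eventually_at_right_field intro: exI[of _ 1])
  have upper: "\<forall>\<^sub>F \<delta> in at_right 0. \<alpha> \<delta> \<le> c2 * \<delta> powr \<kappa>"
    using c2(2) small by eventually_elim (auto dest: pos)
  have lower: "\<forall>\<^sub>F \<delta> in at_right 0. c1 * \<delta> powr \<kappa> \<le> \<alpha> \<delta>"
    using c1(2) small by eventually_elim (auto dest: pos)
  have "((\<lambda>\<delta>::real. \<delta> powr \<kappa>) \<longlongrightarrow> 0) (at_right 0)"
    using tendsto_powr'[of "\<lambda>a::real. a" 0 "at_right 0" "\<lambda>_. \<kappa>" \<kappa>] \<kappa>
    by (auto simp: eventually_at_right_field intro: exI[of _ 1])
  then have z: "((\<lambda>\<delta>::real. c2 * \<delta> powr \<kappa>) \<longlongrightarrow> 0) (at_right 0)"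
    by (rule tendsto_mult_right_zero)
  have lim: "filterlim \<alpha> (at_right 0) (at_right 0)"
  proof (rule filterlim_at_withinI)
    show "(\<alpha> \<longlongrightarrow> 0) (at_right 0)"
    proof (rule tendsto_sandwich[OF _ upper tendsto_const z])
      show "\<forall>\<^sub>F \<delta> in at_right 0. 0 \<le> \<alpha> \<delta>"
        using small by eventually_elim (auto dest: pos)
    qed
    show "\<forall>\<^sub>F \<delta> in at_right 0. \<alpha> \<delta> \<in> {0<..} - {0}"
      using small by eventually_elim (auto dest: pos)
  qed
  define H where "H = c2 powr s1 + c1 powr (s2 - 2)"
  have "\<forall>\<^sub>F \<delta> in at_right 0. \<alpha> \<delta> powr s1 + (\<delta> / \<alpha> \<delta>)\<^sup>2 * \<alpha> \<delta> powr s2 \<le> H * \<delta> powr \<rho>"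
    using small upper lower
  proof eventually_elim
    case (elim \<delta>)
    then have d: "0 < \<delta>" "\<delta> < 1" and a: "0 < \<alpha> \<delta>" using pos by auto
    have "\<alpha> \<delta> powr s1 \<le> (c2 * \<delta> powr \<kappa>) powr s1"
      using elim a s by (intro powr_mono2) auto
    also have "\<dots> = c2 powr s1 * \<delta> powr \<rho>"
      using c2 by (simp add: powr_mult powr_powr rate)
    finally have 1: "\<alpha> \<delta> powr s1 \<le> c2 powr s1 * \<delta> powr \<rho>" .
    have "(\<delta> / \<alpha> \<delta>)\<^sup>2 * \<alpha> \<delta> powr s2 = \<delta> powr 2 * \<alpha> \<delta> powr (s2 - 2)"
      using a d by (simp add: powr_diff power_divide)
    also have "\<dots> \<le> \<delta> powr 2 * (c1 * \<delta> powr \<kappa>) powr (s2 - 2)"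
      using elim a d s c1 by (intro mult_left_mono powr_mono2') auto
    also have "\<dots> = c1 powr (s2 - 2) * \<delta> powr (2 + \<kappa> * (s2 - 2))"
      unfolding powr_add using c1 by (simp add: powr_mult powr_powr)
    also have "\<dots> \<le> c1 powr (s2 - 2) * \<delta> powr \<rho>"
      using d rate by (intro mult_left_mono powr_mono') auto
    finally show ?case using 1 by (simp add: H_def algebra_simps)
  qed
  moreover have "0 < H" using c1 c2 by (simp add: H_def add_pos_pos)
  ultimately show ?thesis using that lim by blast
qed

section \<open>Convergence rates\<close>

text \<open>The order of the estimates matters: the energy estimate with \<open>\<delta> < 1\<close> first confines all
  regularized solutions to a fixed ball of radius \<open>M\<close>; on this ball the Bregman distance dominates
  \<open>m \<parallel>u - v\<parallel>\<^sup>2\<close>, and the same energy estimate, now with its dependence on \<open>\<delta>\<close>, gives the rate.\<close>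

lemma regularization_rate:
  fixes \<iota> :: "'z::real_normed_vector \<Rightarrow>\<^sub>L 'y::real_inner" and K :: "'x::real_normed_vector \<Rightarrow>\<^sub>L 'z"
    and \<alpha> :: "real \<Rightarrow> real"
  assumes p: "1 < p" "p < 2" and q_def: "q = p / (p - 1)"
    and conv: "s_convex_space TYPE('x) 2"
    and nu: "\<nu> \<in> subdifferential (norm_power p) v"
    and r: "0 \<le> r1" "r1 < 1" "0 \<le> r2"
    and src1: "approx_source_condition \<iota> K q C r1 \<nu>"
    and src2: "approx_source_condition \<iota> K q C r2 (ext_adjoint K n)"
    and pos: "\<And>\<delta>. 0 < \<delta> \<Longrightarrow> 0 < \<alpha> \<delta>"
    and \<alpha>: "\<alpha> \<in> \<Theta>[at_right 0](\<lambda>\<delta>. \<delta> powr kappa q r1 r2)"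
  shows "\<exists>c. \<forall>\<^sub>F \<delta> in at_right 0. \<forall>u \<mu>.
    regularized_solution \<iota> K (norm_power p) (noisy_data \<iota> K v n \<delta>) (\<alpha> \<delta>) u \<mu>
    \<longrightarrow> sym_bregman \<mu> \<nu> u v \<le> c * \<delta> powr rate_exponent q r1 r2"
proof -
  have q: "2 < q" using p by (simp add: q_def field_simps)
  define \<sigma>1 \<sigma>2 \<rho> where "\<sigma>1 = 2 * (1 - r1) / nu q r1" and "\<sigma>2 = 2 * (1 - r2) / nu q r2"
    and "\<rho> = rate_exponent q r1 r2"
  note ex = rate_exponents[OF q r, folded \<sigma>1_def \<sigma>2_def \<rho>_def]
  obtain c where c: "0 < c" and conv':
    "\<And>(u::'x) w j. j \<in> duality_map 2 u \<Longrightarrow>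
      (1/2) * norm u powr 2 - blinfun_apply j w + (c/2) * norm w powr 2 \<le> (1/2) * norm (u - w) powr 2"
    using conv unfolding s_convex_space_def by blast
  obtain H where H: "0 < H" and lim: "filterlim \<alpha> (at_right 0) (at_right 0)"
    and bal: "\<forall>\<^sub>F \<delta> in at_right 0. \<alpha> \<delta> powr \<sigma>1 + (\<delta> / \<alpha> \<delta>)\<^sup>2 * \<alpha> \<delta> powr \<sigma>2 \<le> H * \<delta> powr \<rho>"
    by (rule parameter_choice_balances[OF \<alpha> pos ex(1-5)])
  obtain G1 where G1: "0 < G1" and dec1: "\<forall>\<^sub>F a in at_right 0. \<exists>w.
       (norm (ext_adjoint K (pivot_to_dual \<iota> w) - \<nu>))\<^sup>2 \<le> G1 * a powr \<sigma>1 \<and>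
       a * (norm w)\<^sup>2 \<le> G1 * a powr \<sigma>1"
    unfolding \<sigma>1_def by (rule approx_source_decomposition[OF src1 q r(1)])
  obtain G2 where G2: "0 < G2" and dec2: "\<forall>\<^sub>F a in at_right 0. \<exists>w.
       (norm (ext_adjoint K (pivot_to_dual \<iota> w) - ext_adjoint K n))\<^sup>2 \<le> G2 * a powr \<sigma>2 \<and>
       a * (norm w)\<^sup>2 \<le> G2 * a powr \<sigma>2"
    unfolding \<sigma>2_def by (rule approx_source_decomposition[OF src2 q r(3)])
  define L where "L = max G1 G2 * H"
  have L: "0 < L" using G1 H by (simp add: L_def less_max_iff_disj)
  define M where "M = max (max 1 (2 * norm v)) ((4 * (L + 3 / 2 * sqrt (2 * L)) / (p - 1)) powr (1 / (p - 1)))"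
  have M: "1 \<le> M" "norm v \<le> M" by (auto simp: M_def le_max_iff_disj)
  define m where "m = min ((p - 1) / 16) (c / 8) * M powr (p - 2)"
  have m: "0 < m" using p c M by (simp add: m_def)
  have small: "\<forall>\<^sub>F \<delta>::real in at_right 0. 0 < \<delta> \<and> \<delta> < 1"
    by (auto simp: eventually_at_right_field intro: exI[of _ 1])
  have "\<forall>\<^sub>F \<delta> in at_right 0. \<forall>u \<mu>.
    regularized_solution \<iota> K (norm_power p) (noisy_data \<iota> K v n \<delta>) (\<alpha> \<delta>) u \<mu>
    \<longrightarrow> sym_bregman \<mu> \<nu> u v \<le> (2 * (1 + 1 / m) * L) * \<delta> powr \<rho>"
    using small bal eventually_compose_filterlim[OF dec1 lim] eventually_compose_filterlim[OF dec2 lim]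
  proof (eventually_elim, intro allI impI)
    fix \<delta> u \<mu>
    assume \<delta>: "0 < \<delta> \<and> \<delta> < 1"
      and bal: "\<alpha> \<delta> powr \<sigma>1 + (\<delta> / \<alpha> \<delta>)\<^sup>2 * \<alpha> \<delta> powr \<sigma>2 \<le> H * \<delta> powr \<rho>"
      and ex1: "\<exists>w. (norm (ext_adjoint K (pivot_to_dual \<iota> w) - \<nu>))\<^sup>2 \<le> G1 * \<alpha> \<delta> powr \<sigma>1 \<and>
       \<alpha> \<delta> * (norm w)\<^sup>2 \<le> G1 * \<alpha> \<delta> powr \<sigma>1"
      and ex2: "\<exists>w. (norm (ext_adjoint K (pivot_to_dual \<iota> w) - ext_adjoint K n))\<^sup>2 \<le> G2 * \<alpha> \<delta> powr \<sigma>2 \<and>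
       \<alpha> \<delta> * (norm w)\<^sup>2 \<le> G2 * \<alpha> \<delta> powr \<sigma>2"
      and sol: "regularized_solution \<iota> K (norm_power p) (noisy_data \<iota> K v n \<delta>) (\<alpha> \<delta>) u \<mu>"
    define a t G where "a = \<alpha> \<delta>" and "t = \<delta> / a" and "G = max G1 G2"
    have a: "0 < a" and t: "0 < t" using pos \<delta> by (auto simp: a_def t_def)
    define E where "E = L * \<delta> powr \<rho>"
    have E: "0 \<le> E" "E \<le> L"
      using L \<delta> ex(6) by (auto simp: E_def intro: mult_left_le powr_le_one_le powr_le1)
    have GE: "G * a powr \<sigma>1 + t\<^sup>2 * (G * a powr \<sigma>2) \<le> E"
      using mult_left_mono[OF bal, of G] G1
      by (simp add: E_def L_def a_def t_def G_def le_max_iff_disj algebra_simps)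
    from ex1 obtain w1 where "(norm (ext_adjoint K (pivot_to_dual \<iota> w1) - \<nu>))\<^sup>2 \<le> G1 * a powr \<sigma>1"
       "a * (norm w1)\<^sup>2 \<le> G1 * a powr \<sigma>1" by (auto simp: a_def)
    moreover have "G1 * a powr \<sigma>1 \<le> G * a powr \<sigma>1" by (intro mult_right_mono) (auto simp: G_def)
    ultimately have w1: "(norm (ext_adjoint K (pivot_to_dual \<iota> w1) - \<nu>))\<^sup>2 \<le> G * a powr \<sigma>1"
       "a * (norm w1)\<^sup>2 \<le> G * a powr \<sigma>1" by auto
    from ex2 obtain w2 where "(norm (ext_adjoint K (pivot_to_dual \<iota> w2) - ext_adjoint K n))\<^sup>2 \<le> G2 * a powr \<sigma>2"
       "a * (norm w2)\<^sup>2 \<le> G2 * a powr \<sigma>2" by (auto simp: a_def)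
    moreover have "G2 * a powr \<sigma>2 \<le> G * a powr \<sigma>2" by (intro mult_right_mono) (auto simp: G_def)
    ultimately have w2: "(norm (ext_adjoint K (pivot_to_dual \<iota> w2) - ext_adjoint K n))\<^sup>2 \<le> G * a powr \<sigma>2"
       "a * (norm w2)\<^sup>2 \<le> G * a powr \<sigma>2" by auto
    define x1 x2 where "x1 = norm (ext_adjoint K (pivot_to_dual \<iota> w1) - \<nu>)"
      and "x2 = norm (ext_adjoint K (pivot_to_dual \<iota> w2) - ext_adjoint K n)"
    have en: "sym_bregman \<mu> \<nu> u v \<le> a * (norm w1)\<^sup>2 + t\<^sup>2 * (a * (norm w2)\<^sup>2)
        + (x1 + t * x2) * norm (u - v)"
      unfolding t_def x1_def x2_def
      by (rule sym_bregman_energy_estimate)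
         (use sol a \<delta> in \<open>auto simp: regularized_solution_def a_def\<close>)
    have "a * (norm w1)\<^sup>2 + t\<^sup>2 * (a * (norm w2)\<^sup>2) \<le> E"
      using w1(2) mult_left_mono[OF w2(2), of "t\<^sup>2"] GE by simp
    moreover have "x1 + t * x2 \<le> sqrt (2 * E)"
    proof (rule real_le_rsqrt)
      have "(x1 + t * x2)\<^sup>2 \<le> 2 * (x1\<^sup>2 + t\<^sup>2 * x2\<^sup>2)"
        using sum_squares_bound[of x1 "t * x2"] by (simp add: power2_sum power_mult_distrib)
      also have "\<dots> \<le> 2 * E"
        using w1(1) mult_left_mono[OF w2(1), of "t\<^sup>2"] GE by (simp add: x1_def x2_def)
      finally show "(x1 + t * x2)\<^sup>2 \<le> 2 * E" .
    qed
    then have "(x1 + t * x2) * norm (u - v) \<le> sqrt (2 * E) * norm (u - v)"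
      by (rule mult_right_mono) simp
    ultimately have D: "sym_bregman \<mu> \<nu> u v \<le> E + sqrt (2 * E) * norm (u - v)"
      using en by linarith
    have mu': "\<mu> \<in> duality_map p u" and nu': "\<nu> \<in> duality_map p v"
      using subdifferential_norm_power_subset_duality_map[OF p(1)] nu sol
      by (auto simp: regularized_solution_def)
    have "sqrt (2 * E) * norm (u - v) \<le> sqrt (2 * L) * norm (u - v)"
      using E by (intro mult_right_mono) auto
    then have "sym_bregman \<mu> \<nu> u v \<le> L + sqrt (2 * L) * norm (u - v)"
      using D E by linarith
    then have uM: "norm u \<le> M"
      unfolding M_def using L by (intro norm_le_of_sym_bregman_le[OF p mu' nu']) auto
    have "m * (norm (u - v))\<^sup>2 \<le> sym_bregman \<mu> \<nu> u v"
      unfolding m_def by (rule sym_bregman_ge_norm_diff[OF p c conv' mu' nu' uM M(2)])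
    from absorb_linear_term[OF m E(1) this D]
    show "sym_bregman \<mu> \<nu> u v \<le> (2 * (1 + 1 / m) * L) * \<delta> powr \<rho>"
      by (simp add: E_def mult.assoc)
  qed
  then show ?thesis unfolding \<rho>_def by blast
qed

theorem theorem3p11:
  fixes \<iota> :: "'z::banach \<Rightarrow>\<^sub>L 'y::{real_inner,complete_space}"
    and K :: "'x::banach \<Rightarrow>\<^sub>L 'z"
    and n :: "'z \<Rightarrow>\<^sub>L real"
    and f :: 'y
    and udag :: 'x
    and mudag :: "real \<Rightarrow> ('x \<Rightarrow>\<^sub>L real)"
    and r1 r2 C :: "real \<Rightarrow> real"
    and \<alpha> :: "real \<Rightarrow> real \<Rightarrow> real"
  assumes "separable_space (euclidean :: 'x topology)"
    and "separable_space (euclidean :: 'y topology)"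
    and "gelfand_inclusion \<iota>"
  shows "\<exists>Cp :: real \<Rightarrow> real.
    filterlim Cp at_top (at_left 2) \<and>
    (\<forall>p q. 1 < p \<and> p < 2 \<and> q = p / (p - 1) \<and>
       s_smooth_space TYPE('x) p \<and> s_convex_space TYPE('x) 2 \<and>
       (\<exists>T. admissible_topology (norm_power p) K T) \<and>
       minimizing_solution (norm_power p) (\<iota> o\<^sub>L K) f udag \<and>
       mudag p \<in> subdifferential (norm_power p) udag \<and>
       0 \<le> r1 p \<and> r1 p < 1 \<and> 0 \<le> r2 p \<and>
       approx_source_condition \<iota> K q (C p) (r1 p) (mudag p) \<and>
       approx_source_condition \<iota> K q (C p) (r2 p) (ext_adjoint K n) \<and>
       (\<forall>\<delta>>0. \<alpha> p \<delta> > 0) \<and>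
       \<alpha> p \<in> \<Theta>[at_right 0](\<lambda>\<delta>. \<delta> powr kappa q (r1 p) (r2 p))
     \<longrightarrow> (\<forall>\<^sub>F \<delta> in at_right 0. \<forall>u \<mu>.
           regularized_solution \<iota> K (norm_power p) (noisy_data \<iota> K udag n \<delta>) (\<alpha> p \<delta>) u \<mu>
           \<longrightarrow> sym_bregman \<mu> (mudag p) u udag \<le> Cp p * \<delta> powr rate_exponent q (r1 p) (r2 p)))"
proof -
  define adm where "adm p q \<longleftrightarrow> 1 < p \<and> p < 2 \<and> q = p / (p - 1) \<and>
       s_convex_space TYPE('x) 2 \<and>
       mudag p \<in> subdifferential (norm_power p) udag \<and>
       0 \<le> r1 p \<and> r1 p < 1 \<and> 0 \<le> r2 p \<and>
       approx_source_condition \<iota> K q (C p) (r1 p) (mudag p) \<and>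
       approx_source_condition \<iota> K q (C p) (r2 p) (ext_adjoint K n) \<and>
       (\<forall>\<delta>>0. \<alpha> p \<delta> > 0) \<and>
       \<alpha> p \<in> \<Theta>[at_right 0](\<lambda>\<delta>. \<delta> powr kappa q (r1 p) (r2 p))" for p q
  define rated where "rated p q c \<longleftrightarrow> (\<forall>\<^sub>F \<delta> in at_right 0. \<forall>u \<mu>.
       regularized_solution \<iota> K (norm_power p) (noisy_data \<iota> K udag n \<delta>) (\<alpha> p \<delta>) u \<mu>
       \<longrightarrow> sym_bregman \<mu> (mudag p) u udag \<le> c * \<delta> powr rate_exponent q (r1 p) (r2 p))" for p q c
  have ex: "\<exists>c. rated p (p / (p - 1)) c" if "adm p (p / (p - 1))" for p
    unfolding rated_def
    by (rule regularization_rate[where C = "C p"]) (use that in \<open>auto simp: adm_def\<close>)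
  define c where "c p = (SOME c. rated p (p / (p - 1)) c)" for p
  have c: "rated p q (c p)" if "adm p q" for p q
  proof -
    have "q = p / (p - 1)" using that by (simp add: adm_def)
    then show ?thesis unfolding c_def using ex that by (auto intro: someI_ex)
  qed
  have mono: "rated p q c'" if "rated p q c0" "c0 \<le> c'" for p q c0 c'
    using that(1) unfolding rated_def
    by eventually_elim (meson order_trans mult_right_mono powr_ge_zero that(2))
  define Cp where "Cp p = max (c p) (inverse (2 - p))" for p
  have "filterlim (\<lambda>p::real. inverse (2 - p)) at_top (at_left 2)"
  proof (rule filterlim_compose[OF filterlim_inverse_at_top_right])
    show "filterlim (\<lambda>p::real. 2 - p) (at_right 0) (at_left 2)"
    proof (rule filterlim_at_withinI)
      show "((\<lambda>p::real. 2 - p) \<longlongrightarrow> 0) (at_left 2)"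
        by (auto intro!: tendsto_eq_intros)
      show "\<forall>\<^sub>F p::real in at_left 2. 2 - p \<in> {0<..} - {0}"
        by (auto simp: eventually_at_left_field intro: exI[of _ 1])
    qed
  qed
  then have "filterlim Cp at_top (at_left 2)"
    by (rule filterlim_at_top_mono) (simp add: Cp_def)
  moreover have "rated p q (Cp p)" if "adm p q" for p q
    by (rule mono[OF c[OF that]]) (simp add: Cp_def)
  ultimately show ?thesis
    unfolding adm_def rated_def by (intro exI[of _ Cp]) blast
qed

end
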